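(* Let $\mathbb{K}=\mathbb{R}$ or $\mathbb{C}$, let $n\ge2$ and $m\ge1$ be integers, let $G=GL(n,\mathbb{K})$, and let $P$ be its maximal parabolic subgroup such that $G/P\cong\mathbb{P}^{n-1}\mathbb{K}$. Then there are only finitely many $\mathrm{diag}(G)$-orbits on $G^m/P^m$ if and only if $m\le3$.
   Context: $\mathrm{diag}(G)\subset G^m$ denotes the diagonal subgroup, acting on $G^m/P^m\cong(\mathbb{P}^{n-1}\mathbb{K})^m$, i.e. $GL(n,\mathbb{K})$ acts diagonally on $m$-tuples of lines in $\mathbb{K}^n$. *)

theory Defs
  imports
    "HOL-Analysis.Analysis"
    "HOL-Algebra.Left_Coset"
    "HOL-Algebra.Group_Action"
    "HOL-Algebra.Product_Groups"
begin

section \<open>The general linear group and projective space\<close>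

definition GL :: "('a::field^'n^'n) monoid" where
  "GL = \<lparr>carrier = {A. invertible A}, mult = (**), one = mat 1\<rparr>"

lemma GL_simps [simp]:
  "g \<in> carrier GL \<longleftrightarrow> invertible g"
  "g \<otimes>\<^bsub>GL\<^esub> h = g ** h"
  "\<one>\<^bsub>GL\<^esub> = mat 1"
  by (simp_all add: GL_def)

text \<open>\<open>vec\<close> is the structure of \<open>'a^'n\<close> as a vector space over \<open>'a\<close>, so that dimensions over
  the complex numbers are complex dimensions.\<close>

definition projective_space :: "('a::field^'n) set set" where
  "projective_space = {L. vec.subspace L \<and> vec.dim L = 1}"


section \<open>Parabolic subgroups\<close>

definition flag :: "('a::field^'n) set set \<Rightarrow> bool" where
  "flag F \<longleftrightarrow> (\<forall>V\<in>F. vec.subspace V) \<and> (\<forall>V\<in>F. \<forall>W\<in>F. V \<subseteq> W \<or> W \<subseteq> V)"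

definition flag_stabilizer :: "('a::field^'n) set set \<Rightarrow> ('a^'n^'n) set" where
  "flag_stabilizer F = {g \<in> carrier GL. \<forall>V\<in>F. (*v) g ` V = V}"

definition parabolic :: "('a::field^'n^'n) set \<Rightarrow> bool" where
  "parabolic P \<longleftrightarrow> (\<exists>F. flag F \<and> P = flag_stabilizer F)"

definition maximal_parabolic :: "('a::field^'n^'n) set \<Rightarrow> bool" where
  "maximal_parabolic P \<longleftrightarrow> parabolic P \<and> P \<noteq> carrier GL \<and>
     (\<forall>Q. parabolic Q \<and> P \<subset> Q \<longrightarrow> Q = carrier GL)"

text \<open>The identification of \<open>G/P\<close> with projective space is one of \<open>G\<close>-spaces. For \<open>n \<ge> 3\<close>
  equivariance excludes the stabilizers of hyperplanes, whose quotients are dual projective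
  spaces.\<close>

definition quotient_is_projective_space :: "('a::field^'n^'n) set \<Rightarrow> bool" where
  "quotient_is_projective_space P \<longleftrightarrow>
     (\<exists>f. bij_betw f (lcosets\<^bsub>GL\<^esub> P) projective_space \<and>
        (\<forall>g\<in>carrier GL. \<forall>X\<in>lcosets\<^bsub>GL\<^esub> P. f (g <#\<^bsub>GL\<^esub> X) = (*v) g ` f X))"


section \<open>The diagonal action\<close>

definition GL_power :: "nat \<Rightarrow> (nat \<Rightarrow> 'a::field^'n^'n) monoid" where
  "GL_power m = product_group {..<m} (\<lambda>_. GL)"

definition diag_GL :: "nat \<Rightarrow> (nat \<Rightarrow> 'a::field^'n^'n) set" where
  "diag_GL m = (\<lambda>g. \<lambda>i\<in>{..<m}. g) ` carrier GL"

definition quotient_power :: "nat \<Rightarrow> ('a::field^'n^'n) set \<Rightarrow> (nat \<Rightarrow> 'a^'n^'n) set set" where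
  "quotient_power m P = lcosets\<^bsub>GL_power m\<^esub> (\<Pi>\<^sub>E i\<in>{..<m}. P)"

definition diag_orbits :: "nat \<Rightarrow> ('a::field^'n^'n) set \<Rightarrow> (nat \<Rightarrow> 'a^'n^'n) set set set" where
  "diag_orbits m P =
     orbits (GL_power m\<lparr>carrier := diag_GL m\<rparr>) (quotient_power m P)
       (\<lambda>g. \<lambda>X\<in>quotient_power m P. g <#\<^bsub>GL_power m\<^esub> X)"


section \<open>Stabilizers of lines\<close>

text \<open>The subgroups in question exist: stabilizers of lines are maximal parabolic, with quotient
  projective space.\<close>

lemma group_GL: "group (GL :: ('a::field^'n^'n) monoid)"
proof (rule groupI)
  fix g :: "'a^'n^'n" assume "g \<in> carrier GL"
  then obtain h where "g ** h = mat 1" "h ** g = mat 1"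
    by (auto simp: invertible_def)
  then show "\<exists>h\<in>carrier GL. h \<otimes>\<^bsub>GL\<^esub> g = \<one>\<^bsub>GL\<^esub>"
    by (intro bexI[of _ h]) (auto simp: invertible_def)
next
  show "\<one>\<^bsub>GL\<^esub> \<in> carrier (GL :: ('a^'n^'n) monoid)"
    by (auto simp: invertible_def intro!: exI[of _ "mat 1"])
qed (simp_all add: invertible_mult matrix_mul_assoc)

lemma invertible_extending:
  fixes f :: "'a::field^'n \<Rightarrow> 'a^'n"
  assumes "vec.independent B" "vec.independent (f ` B)" "inj_on f B"
  shows "\<exists>g. invertible g \<and> (\<forall>x\<in>B. g *v x = f x)"
proof -
  obtain h where h: "Vector_Spaces.linear (*s) (*s) h" "inj h" "\<forall>x\<in>B. h x = f x"
    using vec.linear_independent_extend_inj[OF assms] by blast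
  have "(*v) (matrix h) = h"
    using matrix_works[OF h(1)] by auto
  then have "invertible (matrix h)"
    using h(2) by (simp add: invertible_left_inverse matrix_left_invertible_injective)
  then show ?thesis
    using h(3) matrix_works[OF h(1)] by metis
qed

lemma projective_space_span:
  assumes "L \<in> projective_space"
  obtains l where "l \<noteq> 0" "L = vec.span {l}"
proof -
  have L: "vec.subspace L" "vec.dim L = 1"
    using assms by (auto simp: projective_space_def)
  obtain B where B: "B \<subseteq> L" "vec.independent B" "L \<subseteq> vec.span B" "card B = vec.dim L"
    using vec.basis_exists by blast
  then obtain l where l: "B = {l}"
    using L(2) by (metis card_1_singletonE)
  have "vec.span B \<subseteq> L"
    using B(1) L(1) by (rule vec.span_minimal)
  then have "L = vec.span {l}"
    using B(3) l by blast
  moreover have "l \<noteq> 0"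
    using B(2) l vec.dependent_zero[of B] by auto
  ultimately show thesis
    using that by blast
qed

lemma image_span:
  fixes g :: "'a::field^'n^'n"
  shows "(*v) g ` vec.span B = vec.span ((*v) g ` B)"
  by (simp add: vec.linear_span_image[symmetric])

lemma image_image_matrix:
  fixes g h :: "'a::field^'n^'n"
  shows "(*v) g ` (*v) h ` B = (*v) (g ** h) ` B"
  by (simp add: image_image matrix_vector_mul_assoc)

lemma projective_space_image:
  fixes g :: "'a::field^'n^'n"
  assumes "invertible g" "L \<in> projective_space"
  shows "(*v) g ` L \<in> projective_space"
proof -
  obtain l where l: "l \<noteq> 0" "L = vec.span {l}"
    using assms(2) by (rule projective_space_span)
  have "g *v l \<noteq> 0"
    using assms(1) l(1) by (metis invertible_left_inverse matrix_left_invertible_ker)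
  then show ?thesis
    using l(2) by (simp add: projective_space_def image_span vec.subspace_span)
qed

lemma projective_space_transitive:
  fixes L M :: "('a::field^'n) set"
  assumes "L \<in> projective_space" "M \<in> projective_space"
  shows "\<exists>g. invertible g \<and> (*v) g ` L = M"
proof -
  obtain l where l: "l \<noteq> 0" "L = vec.span {l}"
    using assms(1) by (rule projective_space_span)
  obtain k where k: "k \<noteq> 0" "M = vec.span {k}"
    using assms(2) by (rule projective_space_span)
  obtain g where "invertible g" "g *v l = k"
    using invertible_extending[of "{l}" "\<lambda>_. k"] l(1) k(1) by auto
  then show ?thesis
    using l(2) k(2) by (auto simp: image_span)
qed

lemma quotient_line_stabilizer:
  fixes L :: "('a::field^'n) set"
  assumes L: "L \<in> projective_space"
  shows "quotient_is_projective_space (flag_stabilizer {L})"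
proof -
  let ?P = "flag_stabilizer {L}"
  have one: "mat 1 \<in> ?P"
    by (auto simp: flag_stabilizer_def invertible_def image_def intro!: exI[of _ "mat 1"])
  define f where "f X = (THE M. \<forall>x\<in>X. (*v) x ` L = M)" for X :: "('a^'n^'n) set"
  have f: "f (a <#\<^bsub>GL\<^esub> ?P) = (*v) a ` L" for a
  proof -
    have *: "\<forall>x \<in> a <#\<^bsub>GL\<^esub> ?P. (*v) x ` L = (*v) a ` L"
      by (auto simp: l_coset_def flag_stabilizer_def simp flip: image_image_matrix)
    have a: "a \<in> a <#\<^bsub>GL\<^esub> ?P"
      using one by (force simp: l_coset_def)
    show ?thesis
      unfolding f_def
    proof (rule the_equality)
      fix M assume "\<forall>x \<in> a <#\<^bsub>GL\<^esub> ?P. (*v) x ` L = M"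
      then show "M = (*v) a ` L"
        using a by blast
    qed (rule *)
  qed
  have sub: "a <#\<^bsub>GL\<^esub> ?P \<subseteq> b <#\<^bsub>GL\<^esub> ?P"
    if ab: "invertible a" "invertible b" "(*v) a ` L = (*v) b ` L" for a b :: "'a^'n^'n"
  proof
    fix x assume "x \<in> a <#\<^bsub>GL\<^esub> ?P"
    then obtain p where p: "x = a ** p" "invertible p" "(*v) p ` L = L"
      by (auto simp: l_coset_def flag_stabilizer_def)
    obtain c where c: "b ** c = mat 1" "c ** b = mat 1"
      using ab(2) by (auto simp: invertible_def)
    have "(*v) (c ** a ** p) ` L = (*v) c ` (*v) b ` L"
      using ab(3) p(3) by (simp flip: image_image_matrix)
    also have "\<dots> = L"
      using c by (simp add: image_image_matrix)
    finally have "c ** a ** p \<in> ?P"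
      using c p(2) ab(1) by (auto simp: flag_stabilizer_def invertible_def[of c] intro!: invertible_mult)
    moreover have "x = b ** (c ** a ** p)"
      using c(1) p(1) by (simp add: matrix_mul_assoc)
    ultimately show "x \<in> b <#\<^bsub>GL\<^esub> ?P"
      by (auto simp: l_coset_def)
  qed
  have "inj_on f (lcosets\<^bsub>GL\<^esub> ?P)"
  proof (rule inj_onI)
    fix X Y assume "X \<in> lcosets\<^bsub>GL\<^esub> ?P" "Y \<in> lcosets\<^bsub>GL\<^esub> ?P" and "f X = f Y"
    then obtain a b where "invertible a" "X = a <#\<^bsub>GL\<^esub> ?P" "invertible b" "Y = b <#\<^bsub>GL\<^esub> ?P"
      by (auto simp: LCOSETS_def)
    then show "X = Y"
      using \<open>f X = f Y\<close> sub[of a b] sub[of b a] by (simp add: f)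
  qed
  moreover have "f ` (lcosets\<^bsub>GL\<^esub> ?P) = projective_space"
  proof
    show "f ` (lcosets\<^bsub>GL\<^esub> ?P) \<subseteq> projective_space"
      using L by (auto simp: LCOSETS_def f projective_space_image)
    show "projective_space \<subseteq> f ` (lcosets\<^bsub>GL\<^esub> ?P)"
    proof
      fix M :: "('a^'n) set" assume "M \<in> projective_space"
      then obtain g where "invertible g" "(*v) g ` L = M"
        using projective_space_transitive[OF L] by blast
      then show "M \<in> f ` (lcosets\<^bsub>GL\<^esub> ?P)"
        by (auto simp: LCOSETS_def f intro!: rev_image_eqI[of "g <#\<^bsub>GL\<^esub> ?P"])
    qed
  qed
  moreover have "f (g <#\<^bsub>GL\<^esub> X) = (*v) g ` f X"
    if gX: "g \<in> carrier GL" "X \<in> lcosets\<^bsub>GL\<^esub> ?P" for g X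
  proof -
    obtain a where a: "invertible a" "X = a <#\<^bsub>GL\<^esub> ?P"
      using gX(2) by (auto simp: LCOSETS_def)
    have "g <#\<^bsub>GL\<^esub> X = (g ** a) <#\<^bsub>GL\<^esub> ?P"
      unfolding a(2) by (auto simp: l_coset_def matrix_mul_assoc)
    then show ?thesis
      by (simp add: f a(2) image_image_matrix)
  qed
  ultimately show ?thesis
    unfolding quotient_is_projective_space_def bij_betw_def by blast
qed

lemma invariant_subspace_line_stabilizer:
  fixes L V :: "('a::field^'n) set"
  assumes L: "L \<in> projective_space" and V: "vec.subspace V"
    and inv: "\<And>g. g \<in> flag_stabilizer {L} \<Longrightarrow> (*v) g ` V = V"
  shows "V = {0} \<or> V = L \<or> V = UNIV"
proof -
  obtain l where l: "l \<noteq> 0" "L = vec.span {l}"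
    using L by (rule projective_space_span)
  show ?thesis
  proof (cases "V \<subseteq> L")
    case True
    show ?thesis
    proof (cases "V = {0}")
      case False
      then obtain v where v: "v \<in> V" "v \<noteq> 0"
        using V vec.subspace_0 by blast
      then obtain c where c: "v = c *s l"
        using True l(2) by (auto simp: vec.span_singleton)
      then have "l = inverse c *s v"
        using v(2) by auto
      then have "l \<in> V"
        using V v(1) vec.subspace_scale by blast
      then have "L \<subseteq> V"
        using V l(2) by (simp add: vec.span_minimal)
      then show ?thesis
        using True by blast
    qed simp
  next
    case False
    then obtain v where v: "v \<in> V" "v \<notin> L"
      by blast
    have out: "w \<in> V" if w: "w \<notin> L" for w
    proof -
      have ne: "v \<noteq> l" "w \<noteq> l"
        using v(2) w l(2) vec.span_base by auto
      have ind: "vec.independent {v, l}" "vec.independent {w, l}"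
        using v(2) w l by (auto simp: vec.independent_insert)
      obtain g where g: "invertible g" "g *v v = w" "g *v l = l"
        using invertible_extending[of "{v, l}" "\<lambda>x. if x = l then l else w"] ind ne
        by (auto simp: insert_commute)
      then have "g \<in> flag_stabilizer {L}"
        using l(2) by (simp add: flag_stabilizer_def image_span)
      then show ?thesis
        using inv g(2) v(1) by blast
    qed
    have "l \<in> V"
    proof -
      have "v + l \<notin> L"
        using v(2) l(2) by (metis add_diff_cancel_right' insertI1 vec.span_base vec.span_diff)
      then have "(v + l) - v \<in> V"
        using out V v(1) vec.subspace_diff by blast
      then show ?thesis
        by simp
    qed
    then have "L \<subseteq> V"
      using V l(2) by (simp add: vec.span_minimal)
    then show ?thesis
      using out by blast
  qed
qed

lemma maximal_parabolic_line_stabilizer: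
  fixes L :: "('a::field^'n) set"
  assumes n: "CARD('n) \<ge> 2" and L: "L \<in> projective_space"
  shows "maximal_parabolic (flag_stabilizer {L})"
proof -
  have sub: "vec.subspace L"
    using L by (simp add: projective_space_def)
  have "parabolic (flag_stabilizer {L})"
    unfolding parabolic_def flag_def using sub by (intro exI[of _ "{L}"]) auto
  moreover have "flag_stabilizer {L} \<noteq> carrier GL"
  proof
    assume eq: "flag_stabilizer {L} = carrier GL"
    have "projective_space \<subseteq> {L}"
    proof
      fix M :: "('a^'n) set" assume "M \<in> projective_space"
      then obtain g where "invertible g" "(*v) g ` L = M"
        using projective_space_transitive[OF L] by blast
      moreover have "g \<in> flag_stabilizer {L}"
        using \<open>invertible g\<close> eq by simp
      ultimately show "M \<in> {L}"
        by (simp add: flag_stabilizer_def)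
    qed
    then have "v \<in> L" for v
    proof (cases "v = 0")
      case False
      then have "vec.span {v} \<in> projective_space"
        by (simp add: projective_space_def vec.subspace_span)
      then show ?thesis
        using \<open>projective_space \<subseteq> {L}\<close> vec.span_base by blast
    qed (simp add: sub vec.subspace_0)
    then have "L = UNIV"
      by blast
    then have "vec.dim (UNIV :: ('a^'n) set) = 1"
      using L by (simp add: projective_space_def)
    then show False
      using n by (simp add: vec.dim_UNIV card_cart_basis)
  qed
  moreover have "Q = carrier GL" if Q: "parabolic Q" "flag_stabilizer {L} \<subset> Q" for Q
  proof -
    obtain F where F: "flag F" "Q = flag_stabilizer F"
      using Q(1) by (auto simp: parabolic_def)
    have triv: "V = {0} \<or> V = L \<or> V = UNIV" if "V \<in> F" for V
    proof (rule invariant_subspace_line_stabilizer[OF L])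
      show "vec.subspace V"
        using F(1) that by (simp add: flag_def)
      show "(*v) g ` V = V" if "g \<in> flag_stabilizer {L}" for g
      proof -
        have "g \<in> flag_stabilizer F"
          using that Q(2) F(2) by blast
        then show ?thesis
          using \<open>V \<in> F\<close> by (simp add: flag_stabilizer_def)
      qed
    qed
    have U: "(*v) g ` UNIV = UNIV" if "invertible g" for g :: "'a^'n^'n"
      using that by (metis invertible_right_inverse matrix_right_invertible_surjective)
    have "L \<notin> F"
    proof
      assume "L \<in> F"
      then have "Q \<subseteq> flag_stabilizer {L}"
        using F(2) by (auto simp: flag_stabilizer_def)
      then show False
        using Q(2) by blast
    qed
    then have "\<forall>V\<in>F. V = {0} \<or> V = UNIV"
      using triv by blast
    moreover have "(*v) g ` {0} = {0}" for g :: "'a^'n^'n"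
      by simp
    ultimately have "(*v) g ` V = V" if "invertible g" "V \<in> F" for g V
      using U that by metis
    then have "g \<in> Q \<longleftrightarrow> g \<in> carrier GL" for g
      unfolding F(2) flag_stabilizer_def GL_simps mem_Collect_eq by blast
    then show ?thesis
      by blast
  qed
  ultimately show ?thesis
    unfolding maximal_parabolic_def by blast
qed

end

theory Submission
  imports Defs
begin

text \<open>Sending a coset \<open>a P\<close> to the line assigned to it identifies orbits on \<open>G\<^sup>m/P\<^sup>m\<close> with classes
  of \<open>m\<close>-tuples of lines up to simultaneous linear equivalence. Three lines are determined up to
  equivalence by which of them coincide and by whether the third lies in the span of the first
  two: three distinct coplanar lines are spanned by \<open>a\<close>, \<open>b\<close>, \<open>a + b\<close> for suitable generators.
  For four lines the cross ratio is an invariant taking infinitely many values.\<close>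

section \<open>Triples of lines\<close>

lemma projective_space_eq_span:
  assumes "L \<in> projective_space" "x \<in> L" "x \<noteq> 0"
  shows "L = vec.span {x}"
proof -
  obtain l where l: "l \<noteq> 0" "L = vec.span {l}"
    using assms(1) by (rule projective_space_span)
  then obtain c where c: "x = c *s l"
    using assms(2) by (auto simp: vec.span_singleton)
  then have "l = inverse c *s x"
    using assms(3) by auto
  then have "l \<in> vec.span {x}"
    using vec.span_base vec.span_scale by blast
  moreover have "x \<in> vec.span {l}"
    using assms(2) l by blast
  ultimately show ?thesis
    unfolding l(2) by (simp add: vec.span_eq)
qed

lemma span_singleton_projective_space:
  fixes l :: "'a::field^'n"
  shows "l \<noteq> 0 \<Longrightarrow> vec.span {l} \<in> projective_space"
  by (simp add: projective_space_def vec.subspace_span)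

lemma projective_space_notin:
  assumes "L \<in> projective_space" "M \<in> projective_space" "L \<noteq> M" "x \<in> L" "x \<noteq> 0"
  shows "x \<notin> M"
  using assms projective_space_eq_span by metis

lemma projective_space_generator:
  assumes "L \<in> projective_space"
  obtains l where "l \<in> L" "l \<noteq> 0"
  using assms by (metis projective_space_span vec.span_base singletonI)

text \<open>Two lines sharing a nonzero vector coincide, so equations between lines reduce to
  following one generator.\<close>

lemma image_line_eqI:
  fixes g :: "'a::field^'n^'n"
  assumes "L \<in> projective_space" "M \<in> projective_space"
    "x \<in> L" "x \<noteq> 0" "g *v x \<in> M" "g *v x \<noteq> 0"
  shows "(*v) g ` L = M"
  using projective_space_eq_span[OF assms(1,3,4)] projective_space_eq_span[OF assms(2,5,6)]
  by (simp add: image_span)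

lemma independent_distinct_lines:
  assumes "A \<in> projective_space" "B \<in> projective_space" "A \<noteq> B"
    "a \<in> A" "a \<noteq> 0" "b \<in> B" "b \<noteq> 0"
  shows "vec.independent {a, b}" "a \<noteq> b"
proof -
  have "a \<notin> vec.span {b}"
    using projective_space_notin[OF assms(1-5)] projective_space_eq_span[OF assms(2,6,7)] by simp
  then show "vec.independent {a, b}" "a \<noteq> b"
    using assms(7) vec.span_base[of b "{b}"] by (auto simp: vec.independent_insert)
qed

section \<open>Invertible matrices with prescribed values on independent vectors\<close>

lemma matrix_extending_pair:
  fixes a b a' b' :: "'a::field^'n"
  assumes "vec.independent {a, b}" "a \<noteq> b" "vec.independent {a', b'}" "a' \<noteq> b'"
  shows "\<exists>g. invertible g \<and> g *v a = a' \<and> g *v b = b'"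
  using invertible_extending[of "{a, b}" "\<lambda>x. if x = a then a' else b'"] assms
  by (auto simp: insert_commute)

text \<open>The vector \<open>c\<close> comes first because independence will be obtained by
  adjoining it outside \<open>vec.span {a, b}\<close>. The inequalities accompany independence
  because \<open>{c, a, b}\<close> is a set, in which repetitions would go unnoticed.\<close>

lemma matrix_extending_triple:
  fixes a b c a' b' c' :: "'a::field^'n"
  assumes "vec.independent {c, a, b} \<and> c \<noteq> a \<and> c \<noteq> b" "a \<noteq> b"
    "vec.independent {c', a', b'} \<and> c' \<noteq> a' \<and> c' \<noteq> b'" "a' \<noteq> b'"
  shows "\<exists>g. invertible g \<and> g *v c = c' \<and> g *v a = a' \<and> g *v b = b'"
proof -
  define f where "f x = (if x = c then c' else if x = a then a' else b')" for x
  have f: "f c = c'" "f a = a'" "f b = b'"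
    using assms by (auto simp: f_def)
  have "vec.independent (f ` {c, a, b})" "inj_on f {c, a, b}"
    using assms by (simp_all add: f inj_on_def) metis
  then show ?thesis
    using invertible_extending[of "{c, a, b}" f] assms by (simp add: f)
qed

section \<open>Pairs and triples of lines up to linear equivalence\<close>

lemma line_pairs_equivalent:
  fixes A B A' B' :: "('a::field^'n) set"
  assumes lines: "A \<in> projective_space" "B \<in> projective_space"
      "A' \<in> projective_space" "B' \<in> projective_space"
    and eq: "A = B \<longleftrightarrow> A' = B'"
  shows "\<exists>g. invertible g \<and> (*v) g ` A = A' \<and> (*v) g ` B = B'"
proof (cases "A = B")
  case True
  then show ?thesis
    using eq projective_space_transitive[OF lines(1,3)] by auto
next
  case False
  obtain a b where ab: "a \<in> A" "a \<noteq> 0" "b \<in> B" "b \<noteq> 0"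
    using lines projective_space_generator by metis
  obtain a' b' where ab': "a' \<in> A'" "a' \<noteq> 0" "b' \<in> B'" "b' \<noteq> 0"
    using lines projective_space_generator by metis
  have "A' \<noteq> B'"
    using False eq by blast
  then obtain g where g: "invertible g" "g *v a = a'" "g *v b = b'"
    using matrix_extending_pair independent_distinct_lines[OF lines(1,2) False ab]
      independent_distinct_lines[OF lines(3,4) _ ab'] by metis
  then show ?thesis
    using image_line_eqI[of A A' a g] image_line_eqI[of B B' b g] lines ab ab' by auto
qed

text \<open>Decompose a generator of \<open>C\<close> along \<open>A\<close> and \<open>B\<close>.
  If one component vanished, the generator would lie in the other line, which would then equal
  \<open>C\<close>. The components absorb all scalars, so a third coplanar line carries no
  parameter.\<close>

lemma coplanar_lines_generators:
  assumes lines: "A \<in> projective_space" "B \<in> projective_space" "C \<in> projective_space"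
    and ne: "A \<noteq> C" "B \<noteq> C" and sub: "C \<subseteq> vec.span (A \<union> B)"
  obtains a b where "a \<in> A" "a \<noteq> 0" "b \<in> B" "b \<noteq> 0" "a + b \<in> C" "a + b \<noteq> 0"
proof -
  have span: "vec.span A = A" "vec.span B = B"
    using lines by (auto simp: projective_space_def)
  obtain c where c: "c \<in> C" "c \<noteq> 0"
    using lines(3) by (rule projective_space_generator)
  then obtain a b where ab: "a \<in> A" "b \<in> B" "c = a + b"
    using sub unfolding vec.span_Un span by blast
  have "c \<notin> A" "c \<notin> B"
    using projective_space_notin lines ne c by metis+
  then have "a \<noteq> 0" "b \<noteq> 0"
    using ab by auto
  then show thesis
    using that ab c by blast
qed

text \<open>If two of the lines coincide, the claim reduces to a pair. Otherwise the generators of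
  the first two lines can be moved freely, and the third line either follows by linearity or has a
  generator independent of them.\<close>

lemma line_triples_equivalent:
  fixes A B C A' B' C' :: "('a::field^'n) set"
  assumes lines: "A \<in> projective_space" "B \<in> projective_space" "C \<in> projective_space"
      "A' \<in> projective_space" "B' \<in> projective_space" "C' \<in> projective_space"
    and eq: "A = B \<longleftrightarrow> A' = B'" "A = C \<longleftrightarrow> A' = C'" "B = C \<longleftrightarrow> B' = C'"
    and coplanar: "C \<subseteq> vec.span (A \<union> B) \<longleftrightarrow> C' \<subseteq> vec.span (A' \<union> B')"
  shows "\<exists>g. invertible g \<and> (*v) g ` A = A' \<and> (*v) g ` B = B' \<and> (*v) g ` C = C'"
proof -
  consider "A = B" | "A = C \<or> B = C" | "A \<noteq> B" "A \<noteq> C" "B \<noteq> C"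
    by blast
  then show ?thesis
  proof cases
    case 1
    then show ?thesis
      using line_pairs_equivalent[of A C A' C'] lines eq by auto
  next
    case 2
    then show ?thesis
      using line_pairs_equivalent[of A B A' B'] lines eq by auto
  next
    case 3
    then have ne': "A' \<noteq> B'" "A' \<noteq> C'" "B' \<noteq> C'"
      using eq by auto
    show ?thesis
    proof (cases "C \<subseteq> vec.span (A \<union> B)")
      case True
      obtain a b where ab: "a \<in> A" "a \<noteq> 0" "b \<in> B" "b \<noteq> 0" and c: "a + b \<in> C" "a + b \<noteq> 0"
        using coplanar_lines_generators[of A B C] lines 3 True by metis
      obtain a' b' where ab': "a' \<in> A'" "a' \<noteq> 0" "b' \<in> B'" "b' \<noteq> 0"
        and c': "a' + b' \<in> C'" "a' + b' \<noteq> 0"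
        using coplanar_lines_generators[of A' B' C'] lines ne' True coplanar by metis
      obtain g where g: "invertible g" "g *v a = a'" "g *v b = b'"
        using matrix_extending_pair independent_distinct_lines[OF lines(1,2) 3(1) ab]
          independent_distinct_lines[OF lines(4,5) ne'(1) ab'] by metis
      \<comment> \<open>The third lines are generated by these sums, so \<open>g\<close> maps
        \<open>C\<close> to \<open>C'\<close> without further choice.\<close>
      then have "g *v (a + b) = a' + b'"
        by (simp add: matrix_vector_right_distrib)
      then show ?thesis
        using image_line_eqI[of A A' a g] image_line_eqI[of B B' b g]
          image_line_eqI[of C C' "a + b" g] lines ab ab' c c' g by auto
    next
      case False
      \<comment> \<open>Stated for arbitrary lines because it is applied to both triples. If
        \<open>c\<close> lay in the span of the other two lines, so would the whole line
        \<open>N\<close> that it generates.\<close>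
      have independent: "vec.independent {c, a, b} \<and> c \<noteq> a \<and> c \<noteq> b"
        if L: "L \<in> projective_space" "M \<in> projective_space" "N \<in> projective_space" "L \<noteq> M"
          and N: "\<not> N \<subseteq> vec.span (L \<union> M)"
          and abc: "a \<in> L" "a \<noteq> 0" "b \<in> M" "b \<noteq> 0" "c \<in> N" "c \<noteq> 0"
        for L M N :: "('a^'n) set" and a b c
      proof -
        have "c \<notin> vec.span (L \<union> M)"
        proof
          assume "c \<in> vec.span (L \<union> M)"
          then have "vec.span {c} \<subseteq> vec.span (L \<union> M)"
            by (simp add: vec.span_minimal vec.subspace_span)
          then show False
            using N projective_space_eq_span[OF L(3) abc(5,6)] by blast
        qed
        moreover have "vec.span {a, b} \<subseteq> vec.span (L \<union> M)"
          using abc by (intro vec.span_mono) auto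
        ultimately have "c \<notin> vec.span {a, b}"
          by blast
        then show ?thesis
          using independent_distinct_lines[OF L(1,2,4) abc(1-4)] vec.span_base[of _ "{a, b}"]
          by (auto simp: vec.independent_insert)
      qed
      obtain a b c where abc: "a \<in> A" "a \<noteq> 0" "b \<in> B" "b \<noteq> 0" "c \<in> C" "c \<noteq> 0"
        using lines projective_space_generator by metis
      obtain a' b' c' where
        abc': "a' \<in> A'" "a' \<noteq> 0" "b' \<in> B'" "b' \<noteq> 0" "c' \<in> C'" "c' \<noteq> 0"
        using lines projective_space_generator by metis
      have "a \<noteq> b" "a' \<noteq> b'"
        using independent_distinct_lines(2) lines 3(1) ne'(1) abc abc' by metis+
      moreover have "vec.independent {c, a, b} \<and> c \<noteq> a \<and> c \<noteq> b"
        using lines 3(1) False abc by (intro independent)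
      moreover have "vec.independent {c', a', b'} \<and> c' \<noteq> a' \<and> c' \<noteq> b'"
        using lines ne'(1) False coplanar abc' by (intro independent) auto
      ultimately obtain g where "invertible g" "g *v c = c'" "g *v a = a'" "g *v b = b'"
        using matrix_extending_triple by metis
      then show ?thesis
        using image_line_eqI[of A A' a g] image_line_eqI[of B B' b g] image_line_eqI[of C C' c g]
          lines abc abc' by auto
    qed
  qed
qed

section \<open>Quadruples of lines\<close>

text \<open>In the affine coordinate "entry at \<open>q\<close> over entry at \<open>p\<close>",
  indices 0, 1, 2, 3 give the points 0, infinity, 1 and \<open>c\<close>. Index 0 falls under the
  last branch together with all indices from 4 on, so longer tuples are filled up with copies of the
  first line.\<close>

definition cross_ratio_lines :: "'n::finite \<Rightarrow> 'n \<Rightarrow> 'a::field \<Rightarrow> nat \<Rightarrow> ('a^'n) set" where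
  "cross_ratio_lines p q c i =
     vec.span {if i = 1 then axis q 1
       else if i = 2 then axis p 1 + axis q 1
       else if i = 3 then axis p 1 + c *s axis q 1
       else axis p 1}"

lemma cross_ratio_lines_projective_space:
  assumes "p \<noteq> q"
  shows "cross_ratio_lines p q c i \<in> projective_space"
  unfolding cross_ratio_lines_def using assms
  by (intro span_singleton_projective_space) (auto simp: vec_eq_iff axis_def)

text \<open>The first three lines do not depend on the parameter. A matrix preserving them acts as a
  scalar on the plane they span, hence preserves every line in it, in particular the fourth.\<close>

lemma cross_ratio_lines_inequivalent:
  fixes g :: "'a::field^'n^'n"
  assumes pq: "p \<noteq> q" and g: "invertible g"
    and eq: "\<And>i. i < 4 \<Longrightarrow> (*v) g ` cross_ratio_lines p q c i = cross_ratio_lines p q d i"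
  shows "c = d"
proof -
  let ?x = "axis p 1 :: 'a^'n" and ?y = "axis q 1 :: 'a^'n"
  have im: "g *v x \<in> (*v) g ` vec.span {x}" for x
    using vec.span_base by blast
  obtain r where r: "g *v ?x = r *s ?x"
    using im[of ?x] eq[of 0] by (auto simp: cross_ratio_lines_def vec.span_singleton)
  obtain s where s: "g *v ?y = s *s ?y"
    using im[of ?y] eq[of 1] by (auto simp: cross_ratio_lines_def vec.span_singleton)
  obtain t where t: "g *v (?x + ?y) = t *s (?x + ?y)"
    using im[of "?x + ?y"] eq[of 2] by (auto simp: cross_ratio_lines_def vec.span_singleton)
  obtain u where u: "g *v (?x + c *s ?y) = u *s (?x + d *s ?y)"
    using im[of "?x + c *s ?y"] eq[of 3] by (auto simp: cross_ratio_lines_def vec.span_singleton)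
  have "r *s ?x + s *s ?y = t *s (?x + ?y)"
    using r s t by (simp add: matrix_vector_right_distrib)
  \<comment> \<open>The entries at \<open>p\<close> and \<open>q\<close> give \<open>r = t\<close>
    and \<open>s = t\<close>.\<close>
  from this[unfolded vec_eq_iff, rule_format, of p] this[unfolded vec_eq_iff, rule_format, of q]
  have "r = s"
    using pq by (simp add: axis_def)
  have "r *s ?x + (c * s) *s ?y = u *s (?x + d *s ?y)"
    using r s u by (simp add: matrix_vector_right_distrib vec.scale)
  from this[unfolded vec_eq_iff, rule_format, of p] this[unfolded vec_eq_iff, rule_format, of q]
  have "r = u" "c * s = u * d"
    using pq by (simp_all add: axis_def)
  \<comment> \<open>With \<open>r = s = u\<close> the equation \<open>c * s = u * d\<close> yields
    \<open>c = d\<close> once this common factor can be cancelled.\<close>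
  moreover have "r \<noteq> 0"
  proof
    assume "r = 0"
    then have "g *v ?x = 0"
      using r by simp
    then have "?x = 0"
      using g by (metis invertible_left_inverse matrix_left_invertible_ker)
    then show False
      by (simp add: axis_eq_0_iff)
  qed
  ultimately show ?thesis
    using \<open>r = s\<close> by simp
qed

section \<open>Orbits as classes of tuples of lines\<close>

text \<open>A point of the quotient of the \<open>m\<close>-fold power, written as a box of cosets.
  Values of \<open>a\<close> outside \<open>{..<m}\<close> are ignored, so representatives may be
  arbitrary functions.\<close>

definition coset_tuple ::
  "nat \<Rightarrow> ('a::field^'n^'n) set \<Rightarrow> (nat \<Rightarrow> 'a^'n^'n) \<Rightarrow> (nat \<Rightarrow> 'a^'n^'n) set" where
  "coset_tuple m P a = (\<Pi>\<^sub>E i\<in>{..<m}. a i <#\<^bsub>GL\<^esub> P)"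

definition coset_tuple_orbit ::
  "nat \<Rightarrow> ('a::field^'n^'n) set \<Rightarrow> (nat \<Rightarrow> 'a^'n^'n) \<Rightarrow> (nat \<Rightarrow> 'a^'n^'n) set set" where
  "coset_tuple_orbit m P a = {coset_tuple m P (\<lambda>i. g ** a i) | g. invertible g}"

section \<open>Cosets and diagonal orbits in coordinates\<close>

lemma invertible_one: "invertible (mat 1 :: 'a::field^'n^'n)"
  unfolding invertible_def by (intro exI[of _ "mat 1"]) simp

lemma l_coset_GL: "a <#\<^bsub>GL\<^esub> P = (**) a ` P"
  by (auto simp: l_coset_def)

lemma carrier_GL_power:
  "a \<in> carrier (GL_power m) \<longleftrightarrow> a \<in> extensional {..<m} \<and> (\<forall>i<m. invertible (a i))"
  by (auto simp: GL_power_def PiE_def Pi_iff)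

lemma l_coset_GL_power:
  "a <#\<^bsub>GL_power m\<^esub> B = (\<lambda>b. \<lambda>i\<in>{..<m}. a i ** b i) ` B"
  by (auto simp: l_coset_def GL_power_def)

lemma l_coset_PiE:
  "a <#\<^bsub>GL_power m\<^esub> (\<Pi>\<^sub>E i\<in>{..<m}. B i) = (\<Pi>\<^sub>E i\<in>{..<m}. a i <#\<^bsub>GL\<^esub> B i)"
proof
  show "a <#\<^bsub>GL_power m\<^esub> (\<Pi>\<^sub>E i\<in>{..<m}. B i) \<subseteq> (\<Pi>\<^sub>E i\<in>{..<m}. a i <#\<^bsub>GL\<^esub> B i)"
    by (auto simp: l_coset_def GL_power_def)
  show "(\<Pi>\<^sub>E i\<in>{..<m}. a i <#\<^bsub>GL\<^esub> B i) \<subseteq> a <#\<^bsub>GL_power m\<^esub> (\<Pi>\<^sub>E i\<in>{..<m}. B i)"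
  proof
    fix x assume x: "x \<in> (\<Pi>\<^sub>E i\<in>{..<m}. a i <#\<^bsub>GL\<^esub> B i)"
    then have "\<forall>i\<in>{..<m}. \<exists>b. b \<in> B i \<and> x i = a i ** b"
      by (fastforce simp: l_coset_GL dest: PiE_mem)
    then obtain b where b: "\<forall>i\<in>{..<m}. b i \<in> B i \<and> x i = a i ** b i"
      by metis
    \<comment> \<open>Members of \<open>PiE\<close> are extensional, so the chosen \<open>b\<close>
      has to be cut off outside \<open>{..<m}\<close>.\<close>
    have "x = (\<lambda>i\<in>{..<m}. a i ** restrict b {..<m} i)"
      using x b by (intro PiE_ext[OF x]) (auto simp: l_coset_GL)
    moreover have "restrict b {..<m} \<in> (\<Pi>\<^sub>E i\<in>{..<m}. B i)"
      using b by auto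
    ultimately show "x \<in> a <#\<^bsub>GL_power m\<^esub> (\<Pi>\<^sub>E i\<in>{..<m}. B i)"
      unfolding l_coset_GL_power by (rule image_eqI)
  qed
qed

text \<open>Frees representatives from the extensionality demanded by
  \<open>carrier (GL_power m)\<close>: restricting a family to \<open>{..<m}\<close> does not change
  its box of cosets.\<close>

lemma quotient_power_eq:
  fixes P :: "('a::field^'n^'n) set"
  shows "quotient_power m P = coset_tuple m P ` {a. \<forall>i<m. invertible (a i)}"
proof -
  have quotient: "quotient_power m P = coset_tuple m P ` carrier (GL_power m)"
    unfolding quotient_power_def LCOSETS_def l_coset_PiE coset_tuple_def
    by (rule UNION_singleton_eq_range)
  show ?thesis
  proof
    show "quotient_power m P \<subseteq> coset_tuple m P ` {a. \<forall>i<m. invertible (a i)}"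
      unfolding quotient by (rule image_mono) (simp add: carrier_GL_power subset_iff)
    show "coset_tuple m P ` {a. \<forall>i<m. invertible (a i)} \<subseteq> quotient_power m P"
    proof
      fix X assume "X \<in> coset_tuple m P ` {a. \<forall>i<m. invertible (a i)}"
      then obtain a where a: "\<forall>i<m. invertible (a i)" "X = coset_tuple m P a"
        by blast
      have "X = coset_tuple m P (restrict a {..<m})"
        unfolding a(2) coset_tuple_def by (intro PiE_cong) auto
      moreover have "restrict a {..<m} \<in> carrier (GL_power m)"
        using a(1) by (simp add: carrier_GL_power)
      ultimately show "X \<in> quotient_power m P"
        unfolding quotient by blast
    qed
  qed
qed

text \<open>The action is a map restricted to \<open>quotient_power m P\<close>, so each point must
  first be known to lie there. A diagonal element then multiplies all representatives by the same
  \<open>g\<close>.\<close>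

lemma diag_orbits_eq:
  "diag_orbits m P = coset_tuple_orbit m P ` {a. \<forall>i<m. invertible (a i)}"
proof -
  have orbit: "orbit (GL_power m\<lparr>carrier := diag_GL m\<rparr>)
      (\<lambda>g. \<lambda>X\<in>quotient_power m P. g <#\<^bsub>GL_power m\<^esub> X) (coset_tuple m P a)
      = coset_tuple_orbit m P a"
    if a: "\<forall>i<m. invertible (a i)" for a :: "nat \<Rightarrow> 'a^'b^'b"
  proof -
    have "coset_tuple m P a \<in> quotient_power m P"
      using a by (auto simp: quotient_power_eq)
    moreover have "(\<lambda>i\<in>{..<m}. g) <#\<^bsub>GL_power m\<^esub> coset_tuple m P a
        = coset_tuple m P (\<lambda>i. g ** a i)" for g
      unfolding coset_tuple_def l_coset_PiE
      by (intro PiE_cong) (auto simp: l_coset_GL image_image matrix_mul_assoc)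
    ultimately show ?thesis
      by (force simp: orbit_def coset_tuple_orbit_def diag_GL_def)
  qed
  have "diag_orbits m P = orbit (GL_power m\<lparr>carrier := diag_GL m\<rparr>)
      (\<lambda>g. \<lambda>X\<in>quotient_power m P. g <#\<^bsub>GL_power m\<^esub> X) ` quotient_power m P"
    unfolding diag_orbits_def orbits_def by blast
  also have "\<dots> = (\<lambda>a. orbit (GL_power m\<lparr>carrier := diag_GL m\<rparr>)
      (\<lambda>g. \<lambda>X\<in>quotient_power m P. g <#\<^bsub>GL_power m\<^esub> X) (coset_tuple m P a))
      ` {a. \<forall>i<m. invertible (a i)}"
    by (subst (2) quotient_power_eq) (simp add: image_image)
  also have "\<dots> = coset_tuple_orbit m P ` {a. \<forall>i<m. invertible (a i)}"
    using orbit by (intro image_cong) auto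
  finally show ?thesis .
qed

section \<open>From cosets to lines along an equivariant bijection\<close>

locale projective_quotient =
  fixes P :: "('a::field^'n^'n) set" and f :: "('a^'n^'n) set \<Rightarrow> ('a^'n) set"
  assumes nonempty: "P \<noteq> {}"
    and bij: "bij_betw f (lcosets\<^bsub>GL\<^esub> P) projective_space"
    and equivariant:
      "\<lbrakk>invertible g; X \<in> lcosets\<^bsub>GL\<^esub> P\<rbrakk> \<Longrightarrow> f (g <#\<^bsub>GL\<^esub> X) = (*v) g ` f X"
begin

definition line :: "'a^'n^'n \<Rightarrow> ('a^'n) set" where
  "line a = f (a <#\<^bsub>GL\<^esub> P)"

lemma coset_in: "invertible a \<Longrightarrow> a <#\<^bsub>GL\<^esub> P \<in> lcosets\<^bsub>GL\<^esub> P"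
  by (auto simp: LCOSETS_def)

lemma line_projective_space: "invertible a \<Longrightarrow> line a \<in> projective_space"
  unfolding line_def using coset_in bij bij_betwE by blast

lemma line_surj:
  assumes "L \<in> projective_space"
  obtains a where "invertible a" "line a = L"
proof -
  have "L \<in> f ` (lcosets\<^bsub>GL\<^esub> P)"
    using assms bij by (simp add: bij_betw_def)
  then show thesis
    using that by (auto simp: LCOSETS_def line_def)
qed

lemma line_mult:
  assumes "invertible g" "invertible a"
  shows "line (g ** a) = (*v) g ` line a"
proof -
  have "(g ** a) <#\<^bsub>GL\<^esub> P = g <#\<^bsub>GL\<^esub> (a <#\<^bsub>GL\<^esub> P)"
    by (auto simp: l_coset_GL image_image matrix_mul_assoc)
  then show ?thesis
    unfolding line_def using assms equivariant coset_in by simp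
qed

lemma coset_eq_iff:
  assumes "invertible a" "invertible b"
  shows "a <#\<^bsub>GL\<^esub> P = b <#\<^bsub>GL\<^esub> P \<longleftrightarrow> line a = line b"
  unfolding line_def using assms coset_in bij by (metis bij_betw_def inj_on_eq_iff)

text \<open>A box with nonempty factors determines its factors, and each coset is determined by its
  line. This is where \<open>nonempty\<close> enters.\<close>

lemma coset_tuple_eq_iff:
  assumes "\<forall>i<m. invertible (a i)" "\<forall>i<m. invertible (b i)"
  shows "coset_tuple m P a = coset_tuple m P b \<longleftrightarrow> (\<forall>i<m. line (a i) = line (b i))"
proof -
  have "a i <#\<^bsub>GL\<^esub> P \<noteq> {}" for a :: "nat \<Rightarrow> 'a^'n^'n" and i
    using nonempty by (simp add: l_coset_GL)
  then have "coset_tuple m P a = coset_tuple m P b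
      \<longleftrightarrow> (\<forall>i\<in>{..<m}. a i <#\<^bsub>GL\<^esub> P = b i <#\<^bsub>GL\<^esub> P)"
    unfolding coset_tuple_def by (subst PiE_eq_iff) auto
  then show ?thesis
    using assms coset_eq_iff by auto
qed

text \<open>Forwards, the orbit of \<open>b\<close> contains the point of \<open>b\<close> itself,
  which is therefore a translate of the point of \<open>a\<close>. Backwards, a matrix matching the
  lines matches the points, and so the orbits.\<close>

lemma coset_tuple_orbit_eq_iff:
  assumes a: "\<forall>i<m. invertible (a i)" and b: "\<forall>i<m. invertible (b i)"
  shows "coset_tuple_orbit m P a = coset_tuple_orbit m P b \<longleftrightarrow>
    (\<exists>g. invertible g \<and> (\<forall>i<m. (*v) g ` line (a i) = line (b i)))"
proof
  assume "coset_tuple_orbit m P a = coset_tuple_orbit m P b"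
  moreover have "coset_tuple m P b \<in> coset_tuple_orbit m P b"
    unfolding coset_tuple_orbit_def by (auto simp: invertible_one intro!: exI[of _ "mat 1"])
  ultimately have "coset_tuple m P b \<in> coset_tuple_orbit m P a"
    by simp
  then obtain g where g: "invertible g" "coset_tuple m P b = coset_tuple m P (\<lambda>i. g ** a i)"
    unfolding coset_tuple_orbit_def by blast
  have "\<forall>i<m. line (b i) = line (g ** a i)"
    using coset_tuple_eq_iff[of m b "\<lambda>i. g ** a i"] g a b invertible_mult by blast
  then show "\<exists>g. invertible g \<and> (\<forall>i<m. (*v) g ` line (a i) = line (b i))"
    using g(1) a line_mult by metis
next
  assume "\<exists>g. invertible g \<and> (\<forall>i<m. (*v) g ` line (a i) = line (b i))"
  then obtain g where g: "invertible g" "\<forall>i<m. (*v) g ` line (a i) = line (b i)"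
    by blast
  \<comment> \<open>\<open>g ** a i\<close> and \<open>b i\<close> have the same line, and by
    equivariance this persists after multiplication by \<open>h\<close>.\<close>
  have translate: "coset_tuple m P (\<lambda>i. (h ** g) ** a i) = coset_tuple m P (\<lambda>i. h ** b i)"
    if h: "invertible h" for h
  proof (subst coset_tuple_eq_iff)
    show "\<forall>i<m. line (h ** g ** a i) = line (h ** b i)"
      using g a b h by (simp add: line_mult invertible_mult flip: image_image_matrix)
  qed (use a b g h in \<open>simp_all add: invertible_mult\<close>)
  obtain g' where g': "g ** g' = mat 1" "g' ** g = mat 1"
    using g(1) by (auto simp: invertible_def)
  then have inv: "invertible g'"
    by (auto simp: invertible_def)
  show "coset_tuple_orbit m P a = coset_tuple_orbit m P b"
  proof
    show "coset_tuple_orbit m P b \<subseteq> coset_tuple_orbit m P a"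
      unfolding coset_tuple_orbit_def using translate invertible_mult[OF _ g(1)] by blast
    show "coset_tuple_orbit m P a \<subseteq> coset_tuple_orbit m P b"
    proof
      fix X assume "X \<in> coset_tuple_orbit m P a"
      then obtain h where h: "invertible h" "X = coset_tuple m P (\<lambda>i. h ** a i)"
        by (auto simp: coset_tuple_orbit_def)
      \<comment> \<open>Writing \<open>h\<close> as a multiple of \<open>g\<close> makes
        \<open>translate\<close> applicable to \<open>h ** g'\<close>.\<close>
      have "h ** g' ** g = h"
        using g' by (simp flip: matrix_mul_assoc)
      then have "X = coset_tuple m P (\<lambda>i. (h ** g') ** b i)"
        using translate[of "h ** g'"] h inv invertible_mult by metis
      then show "X \<in> coset_tuple_orbit m P b"
        unfolding coset_tuple_orbit_def using h inv invertible_mult by blast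
    qed
  qed
qed

text \<open>The orbit is a function of four truth values, the invariants of
  \<open>line_triples_equivalent\<close>, so there are at most 16 orbits.\<close>

lemma finite_diag_orbits:
  assumes m: "1 \<le> m" "m \<le> 3"
  shows "finite (diag_orbits m P)"
proof -
  let ?C = "{a :: nat \<Rightarrow> 'a^'n^'n. \<forall>i<m. invertible (a i)}"
  \<comment> \<open>tuples with \<open>m < 3\<close> are padded to triples by repeating the line with index 0\<close>
  define l where "l a i = line (a (if i < m then i else 0))" for a and i :: nat
  define p where "p a = (l a 0 = l a 1, l a 0 = l a 2, l a 1 = l a 2,
    l a 2 \<subseteq> vec.span (l a 0 \<union> l a 1))" for a
  have same: "coset_tuple_orbit m P a = coset_tuple_orbit m P b"
    if ab: "a \<in> ?C" "b \<in> ?C" "p a = p b" for a b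
  proof -
    \<comment> \<open>By \<open>1 \<le> m\<close> the padding index 0 is a genuine index, so padded
      entries are lines too.\<close>
    have l: "l c i \<in> projective_space" if "c \<in> ?C" for c i
      using that m by (auto simp: l_def intro!: line_projective_space)
    obtain g where g: "invertible g"
      "(*v) g ` l a 0 = l b 0" "(*v) g ` l a 1 = l b 1" "(*v) g ` l a 2 = l b 2"
      using line_triples_equivalent[of "l a 0" "l a 1" "l a 2" "l b 0" "l b 1" "l b 2"]
        l ab by (auto simp: p_def)
    have "(*v) g ` line (a i) = line (b i)" if "i < m" for i
    proof -
      have "i = 0 \<or> i = 1 \<or> i = 2"
        using that m by auto
      then have "(*v) g ` l a i = l b i"
        using g by auto
      then show ?thesis
        using that by (simp add: l_def)
    qed
    then show ?thesis
      using ab g(1) coset_tuple_orbit_eq_iff by auto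
  qed
  \<comment> \<open>\<open>inv_into\<close> picks one tuple for each pattern of truth values. For
    patterns that do not occur its value is arbitrary, which an inclusion tolerates.\<close>
  have "coset_tuple_orbit m P ` ?C \<subseteq> (\<lambda>x. coset_tuple_orbit m P (inv_into ?C p x)) ` UNIV"
  proof
    fix X assume "X \<in> coset_tuple_orbit m P ` ?C"
    then obtain a where a: "a \<in> ?C" "X = coset_tuple_orbit m P a"
      by blast
    have "X = coset_tuple_orbit m P (inv_into ?C p (p a))"
      unfolding a(2) using a(1) by (intro same) (auto simp only: inv_into_into f_inv_into_f imageI)
    then show "X \<in> (\<lambda>x. coset_tuple_orbit m P (inv_into ?C p x)) ` UNIV"
      by blast
  qed
  then show ?thesis
    unfolding diag_orbits_eq by (rule finite_subset) simp
qed

text \<open>An equivalence of \<open>m\<close>-tuples restricts to the first four lines, so distinct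
  parameters give distinct orbits and the infinite field embeds into the set of orbits.\<close>

lemma infinite_diag_orbits:
  assumes n: "CARD('n) \<ge> 2" and m: "m \<ge> 4" and inf: "infinite (UNIV :: 'a set)"
  shows "infinite (diag_orbits m P)"
proof -
  obtain p q :: 'n where pq: "p \<noteq> q"
    using n card_le_Suc0_iff_eq[of "UNIV :: 'n set"] by fastforce
  have "\<forall>c i. \<exists>a. invertible a \<and> line a = cross_ratio_lines p q c i"
    using line_surj cross_ratio_lines_projective_space[OF pq] by metis
  then obtain a where a: "\<And>c i. invertible (a c i)"
    "\<And>c i. line (a c i) = cross_ratio_lines p q c i"
    by metis
  have "inj (\<lambda>c. coset_tuple_orbit m P (a c))"
  proof (rule injI)
    fix c d assume "coset_tuple_orbit m P (a c) = coset_tuple_orbit m P (a d)"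
    then obtain g where g: "invertible g"
      "\<forall>i<m. (*v) g ` cross_ratio_lines p q c i = cross_ratio_lines p q d i"
      using coset_tuple_orbit_eq_iff[of m "a c" "a d"] a by auto
    show "c = d"
      using g(2) less_le_trans[OF _ m] by (intro cross_ratio_lines_inequivalent[OF pq g(1)]) blast
  qed
  then have "infinite (range (\<lambda>c. coset_tuple_orbit m P (a c)))"
    using inf finite_imageD by blast
  moreover have "range (\<lambda>c. coset_tuple_orbit m P (a c)) \<subseteq> diag_orbits m P"
    unfolding diag_orbits_eq using a by auto
  ultimately show ?thesis
    using finite_subset by blast
qed

end

text \<open>Stated over an arbitrary infinite field so that the real and the complex case are both
  instances; each has characteristic 0 and is therefore infinite.\<close>

lemma finite_diag_orbits_iff:
  fixes P :: "('a::field^'n^'n) set"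
  assumes n: "CARD('n) \<ge> 2" and m: "m \<ge> 1" and inf: "infinite (UNIV :: 'a set)"
    and P: "parabolic P" "quotient_is_projective_space P"
  shows "finite (diag_orbits m P) \<longleftrightarrow> m \<le> 3"
proof -
  obtain f where f: "bij_betw f (lcosets\<^bsub>GL\<^esub> P) projective_space"
    "\<forall>g\<in>carrier GL. \<forall>X\<in>lcosets\<^bsub>GL\<^esub> P. f (g <#\<^bsub>GL\<^esub> X) = (*v) g ` f X"
    using P(2) unfolding quotient_is_projective_space_def by blast
  \<comment> \<open>A flag stabilizer contains the identity, which supplies the nonemptiness
    required by the locale.\<close>
  have "mat 1 \<in> P"
    using P(1) by (auto simp: parabolic_def flag_stabilizer_def invertible_one)
  then interpret projective_quotient P f
    using f by unfold_locales auto
  show ?thesis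
    using finite_diag_orbits[OF m] infinite_diag_orbits[OF n _ inf, of m] by linarith
qed

theorem corollary4p3:
  fixes m :: nat
  assumes "CARD('n::finite) \<ge> 2" and "m \<ge> 1"
  shows "(\<forall>P :: (real^'n^'n) set.
            maximal_parabolic P \<and> quotient_is_projective_space P \<longrightarrow>
            (finite (diag_orbits m P) \<longleftrightarrow> m \<le> 3)) \<and>
         (\<forall>P :: (complex^'n^'n) set.
            maximal_parabolic P \<and> quotient_is_projective_space P \<longrightarrow>
            (finite (diag_orbits m P) \<longleftrightarrow> m \<le> 3))"
  by (simp add: maximal_parabolic_def finite_diag_orbits_iff[OF assms infinite_UNIV_char_0])

end
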